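(* Let $n\ge0$ be an integer and let $D^n_1$ be the $(n+1)\times(n+1)$ matrix with entries $$(D^n_1)_{i,j}=2\int_0^1 h^n_i(t)\,\hat p_j(2t-1)\,dt,\qquad 0\le i,j\le n,$$ where $h^n_i$ and $\hat p_j$ are as defined in the context. All entries of $D^n_1$ are zero except possibly the following ones, which are given by the stated formulas: (a) $(D^n_1)_{n,n}=\sqrt2$; (b) for $i$ odd and $0\le j\le i\le n$, $$(D^n_1)_{n-i,n-j}=c_{n,i,j}(-1)^{n+j}\sqrt{2(n-i)+1}\sqrt{2(n-j)+1}\;{}_4F_3\!\left({-\frac{i-j}{2},\ \frac{j-i+1}{2},\ n-\frac{i+j-1}{2},\ n-\frac{i+j}{2}+1\atop n-\frac{i}{2}+\frac32,\ -\frac{i}{2},\ n-i+\frac32};\,1\right),$$ where $$c_{n,i,j}=2^{i/2}\,\frac{i!!\,(n-i+\frac32)_{\frac{i-1}{2}}\,(-n+j)_{n-i}\,(n-j+1)_{n-i}}{(2n-i+1)!};$$ (c) for $i$ even and positive, $1\le j\le i\le n$, $$(D^n_1)_{n-i,n-j}=(D^{n-1}_1)_{n-i,n-j}.$$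
   Context: Notation: $(a)_0=1$, $(a)_m=a(a+1)\cdots(a+m-1)$ for $m>0$; empty products equal $1$; $i!!=i(i-2)\cdots 3\cdot1$ for odd $i$; ${}_4F_3\left({a_1,a_2,a_3,a_4\atop b_1,b_2,b_3};t\right)=\sum_{m\ge0}\frac{(a_1)_m(a_2)_m(a_3)_m(a_4)_m}{(b_1)_m(b_2)_m(b_3)_m\,m!}t^m$ (the series here terminates). Rows and columns of matrices are indexed from $0$. $\hat p_j$ is the Legendre polynomial of degree $j$ with positive leading coefficient, orthonormal on $[-1,1]$: $\int_{-1}^1\hat p_j(t)\hat p_k(t)\,dt=\delta_{j,k}$. Definition of $h^n_j$: for an integer $n\ge0$, $0\le k\le n$, and $0\le i\le n$ with $i=0$ or $i$ odd, let $$d^i_{n,k}=(-1)^n\frac{\sqrt{2n-2i+1}}{(-n)_i}\frac{(-n)_k(n-i+1)_k}{(1)_k(1)_k}\prod_{m=0}^{\frac{i-1}{2}}(n+k+1-2m)\prod_{m=0}^{\frac{i-3}{2}}(n-k-1-2m).$$ For $0\le t<1$ let $h_{n-i}^n(t)=\sum_{k=0}^n d^i_{n,k}t^k$ if $i=0$ or $i$ is odd, and $h_{n-i}^n(t)=\sum_{k=0}^{n-1} d^{i-1}_{n-1,k}t^k$ if $i>0$ is even ($0\le i\le n$). (The values on $[-1,0)$, given by $h^n_i(-t)=(-1)^{i+1}h^n_i(t)$, are not needed for $D^n_1$.) *)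

theory Defs
  imports
    "HOL-Analysis.Analysis"
    "HOL-Computational_Algebra.Polynomial"
    "Jordan_Normal_Form.Matrix"
begin

definition legendre_system :: "(nat \<Rightarrow> real poly) \<Rightarrow> bool" where
  "legendre_system p \<longleftrightarrow>
     (\<forall>j. degree (p j) = j \<and> lead_coeff (p j) > 0) \<and>
     (\<forall>j k. integral {-1..1} (\<lambda>t. poly (p j) t * poly (p k) t) = (if j = k then 1 else 0))"

(* Well defined by the lemma legendre_system_ex1 below. *)
definition legendre :: "nat \<Rightarrow> real poly" where
  "legendre = (THE p. legendre_system p)"

(* The two products run over m = 0, ..., (i-1)/2 and m = 0, ..., (i-3)/2. For odd i, and for i = 0,
   where both are empty, these ranges are m < (i+1) div 2 and m < i div 2.
   Only i = 0 and odd i are used. *)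
definition d_coeff :: "nat \<Rightarrow> nat \<Rightarrow> nat \<Rightarrow> real" where
  "d_coeff n i k =
     (-1) ^ n * (sqrt (2 * real n - 2 * real i + 1) / pochhammer (- real n) i)
     * (pochhammer (- real n) k * pochhammer (real n - real i + 1) k
        / (pochhammer 1 k * pochhammer 1 k))
     * (\<Prod>m<(i + 1) div 2. real n + real k + 1 - 2 * real m)
     * (\<Prod>m<i div 2. real n - real k - 1 - 2 * real m)"

(* h_fun n j is the polynomial that represents h^n_j on [0,1), for j \<le> n;
   the branch on [-1,0) is left out. *)
definition h_fun :: "nat \<Rightarrow> nat \<Rightarrow> real \<Rightarrow> real" where
  "h_fun n j t =
     (let i = n - j in
      if i = 0 \<or> odd i then (\<Sum>k=0..n. d_coeff n i k * t ^ k)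
      else (\<Sum>k=0..n - 1. d_coeff (n - 1) (i - 1) k * t ^ k))"

definition D1 :: "nat \<Rightarrow> real mat" where
  "D1 n = mat (n + 1) (n + 1)
     (\<lambda>(i, j). 2 * integral {0..1} (\<lambda>t. h_fun n i t * poly (legendre j) (2 * t - 1)))"

definition hypergeometric_4F3 ::
    "real \<Rightarrow> real \<Rightarrow> real \<Rightarrow> real \<Rightarrow> real \<Rightarrow> real \<Rightarrow> real \<Rightarrow> real \<Rightarrow> real" where
  "hypergeometric_4F3 a1 a2 a3 a4 b1 b2 b3 t =
     (\<Sum>m. pochhammer a1 m * pochhammer a2 m * pochhammer a3 m * pochhammer a4 m
         / (pochhammer b1 m * pochhammer b2 m * pochhammer b3 m * fact m) * t ^ m)"

fun double_fact :: "nat \<Rightarrow> nat" where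
  "double_fact 0 = 1"
| "double_fact (Suc 0) = 1"
| "double_fact (Suc (Suc n)) = Suc (Suc n) * double_fact n"

(* Used for odd i with j \<le> i \<le> n, so that the natural-number operations n - i, (i - 1) div 2
   and 2 * n - i + 1 are exact. *)
definition c_coeff :: "nat \<Rightarrow> nat \<Rightarrow> nat \<Rightarrow> real" where
  "c_coeff n i j =
     2 powr (real i / 2)
     * (real (double_fact i)
        * pochhammer (real n - real i + 3/2) ((i - 1) div 2)
        * pochhammer (- real n + real j) (n - i)
        * pochhammer (real n - real j + 1) (n - i)
        / fact (2 * n - i + 1))"


lemma hypergeometric_4F3_eq_eval_fps:
  "hypergeometric_4F3 a1 a2 a3 a4 b1 b2 b3 t
     = eval_fps (fps_hypergeo [a1, a2, a3, a4] [b1, b2, b3] 1) t"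
  by (simp add: hypergeometric_4F3_def eval_fps_def)


subsection \<open>Existence and uniqueness of the orthonormal Legendre polynomials\<close>

definition poly_ip :: "real poly \<Rightarrow> real poly \<Rightarrow> real" where
  "poly_ip p q = integral {-1..1} (\<lambda>t. poly p t * poly q t)"

lemma poly_ip_integrable: "(\<lambda>t. poly p t * poly q t) integrable_on {-1..1::real}"
  by (intro integrable_continuous_interval continuous_intros)

lemma poly_ip_commute: "poly_ip p q = poly_ip q p"
  by (simp add: poly_ip_def mult.commute)

lemma poly_ip_add_left: "poly_ip (p + q) r = poly_ip p r + poly_ip q r"
  by (simp add: poly_ip_def distrib_right integral_add poly_ip_integrable)

lemma poly_ip_smult_left: "poly_ip (Polynomial.smult c p) r = c * poly_ip p r"
  by (simp add: poly_ip_def mult.assoc)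

lemma poly_ip_0_left: "poly_ip 0 r = 0"
  by (simp add: poly_ip_def)

lemma poly_ip_diff_left: "poly_ip (p - q) r = poly_ip p r - poly_ip q r"
  using poly_ip_add_left[of p "Polynomial.smult (-1) q" r] poly_ip_smult_left[of "-1" q r] by simp

lemma poly_ip_sum_left: "finite A \<Longrightarrow> poly_ip (sum f A) r = (\<Sum>k\<in>A. poly_ip (f k) r)"
  by (induction A rule: finite_induct) (simp_all add: poly_ip_add_left poly_ip_0_left)

lemma poly_ip_pos:
  assumes "p \<noteq> 0" shows "poly_ip p p > 0"
proof -
  have nn: "poly_ip p p \<ge> 0"
    unfolding poly_ip_def by (intro integral_nonneg poly_ip_integrable) auto
  have "poly_ip p p \<noteq> 0"
  proof
    assume 0: "poly_ip p p = 0"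
    have "integral {-1..1} (\<lambda>t. poly p t * poly p t) = 0
        \<longleftrightarrow> (\<forall>t\<in>{-1..1}. poly p t * poly p t = 0)"
      by (intro integral_eq_0_iff continuous_intros) simp_all
    then have "\<forall>t\<in>{-1..1}. poly p t * poly p t = 0"
      using 0 by (simp add: poly_ip_def)
    then have "{-1<..<1::real} \<subseteq> {t. poly p t = 0}" by auto
    then have "finite {-1<..<1::real}"
      using poly_roots_finite[OF assms] finite_subset by blast
    then show False by (simp add: infinite_Ioo)
  qed
  with nn show ?thesis by simp
qed

lemma poly_ip_orthogonal_lower:
  assumes p: "\<And>k. k < n \<Longrightarrow> p k \<noteq> 0 \<and> degree (p k) = k"
    and orth: "\<And>k. k < n \<Longrightarrow> poly_ip (p k) s = 0"
    and r: "r = 0 \<or> degree r < n"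
  shows "poly_ip r s = 0"
  using r
proof (induction "degree r" arbitrary: r rule: less_induct)
  case less
  show ?case
  proof (cases "r = 0")
    case True
    then show ?thesis by (simp add: poly_ip_0_left)
  next
    case False
    define d where "d = degree r"
    have dn: "d < n" using less.prems False d_def by simp
    define c where "c = lead_coeff r / lead_coeff (p d)"
    define r' where "r' = r - Polynomial.smult c (p d)"
    have pd: "p d \<noteq> 0" "degree (p d) = d" using p[OF dn] by auto
    have "coeff (p d) d \<noteq> 0" using pd by (metis leading_coeff_0_iff)
    then have "coeff r' d = 0" using pd(2) by (simp add: r'_def c_def) (simp add: d_def)
    moreover have "degree r' \<le> d"
      unfolding r'_def using pd by (intro degree_diff_le) (auto simp: d_def)
    ultimately have r': "r' = 0 \<or> degree r' < d"
      by (metis leading_coeff_0_iff le_neq_implies_less)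
    have "poly_ip r' s = 0"
      using r' less.hyps[of r'] dn by (auto simp: d_def poly_ip_0_left)
    moreover have "r = r' + Polynomial.smult c (p d)" by (simp add: r'_def)
    ultimately show ?thesis
      using orth[OF dn] by (simp add: poly_ip_add_left poly_ip_smult_left)
  qed
qed

lemma legendre_system_unique:
  assumes p: "legendre_system p" and q: "legendre_system q"
  shows "p = q"
proof
  fix n
  have P: "degree (p k) = k" "lead_coeff (p k) > 0"
    "poly_ip (p k) (p l) = (if k = l then 1 else 0)" for k l
    using p unfolding legendre_system_def poly_ip_def by blast+
  have P0: "p k \<noteq> 0" for k
    using P(2)[of k] by (metis leading_coeff_0_iff less_irrefl)
  have Q: "degree (q k) = k" "lead_coeff (q k) > 0"
    "poly_ip (q k) (q l) = (if k = l then 1 else 0)" for k l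
    using q unfolding legendre_system_def poly_ip_def by blast+
  show "p n = q n"
  proof (induction n rule: less_induct)
    case (less n)
    define c where "c = lead_coeff (p n) / lead_coeff (q n)"
    have c: "c > 0" using P(2) Q(2) by (simp add: c_def)
    define r where "r = p n - Polynomial.smult c (q n)"
    have "coeff r n = 0" using Q(2)[of n] by (simp add: r_def c_def P(1) Q(1))
    moreover have "degree r \<le> n"
      unfolding r_def using P(1) Q(1) by (intro degree_diff_le) auto
    ultimately have r: "r = 0 \<or> degree r < n"
      by (metis leading_coeff_0_iff le_neq_implies_less)
    have "poly_ip (p k) r = 0" if "k < n" for k
    proof -
      have "poly_ip r (p k) = poly_ip (p n) (p k) - c * poly_ip (q n) (q k)"
        using less[OF that] by (simp add: r_def poly_ip_diff_left poly_ip_smult_left)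
      then show ?thesis using that by (simp add: P(3) Q(3) poly_ip_commute)
    qed
    then have "poly_ip r r = 0"
      using poly_ip_orthogonal_lower[of n p r r] P(1) P0 r by blast
    then have "r = 0" using poly_ip_pos[of r] by force
    then have eq: "p n = Polynomial.smult c (q n)" by (simp add: r_def)
    have "1 = poly_ip (p n) (p n)" using P(3) by simp
    also have "\<dots> = c * (c * poly_ip (q n) (q n))"
      unfolding eq by (metis poly_ip_smult_left poly_ip_commute)
    finally have "c\<^sup>2 = 1" using Q(3) by (simp add: power2_eq_square)
    then have "c = 1" using c by (simp add: power2_eq_1_iff)
    then show ?case using eq by simp
  qed
qed

lemma legendre_system_step:
  assumes p: "\<And>k. k < n \<Longrightarrow> degree (p k) = k"
    and orth: "\<And>k l. k < n \<Longrightarrow> l < n \<Longrightarrow> poly_ip (p k) (p l) = (if k = l then 1 else 0)"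
  shows "\<exists>q. degree q = n \<and> lead_coeff q > 0 \<and> poly_ip q q = 1 \<and> (\<forall>k<n. poly_ip q (p k) = 0)"
proof -
  define s where "s = (\<Sum>k<n. Polynomial.smult (poly_ip (monom 1 n) (p k)) (p k))"
  define q where "q = monom 1 n - s"
  have s: "coeff s m = 0" if "m \<ge> n" for m
    unfolding s_def coeff_sum using that p by (intro sum.neutral) (auto intro!: coeff_eq_0)
  have cq: "coeff q n = 1" using s[of n] by (simp add: q_def)
  have dq: "degree q = n"
  proof (rule antisym)
    show "degree q \<le> n" by (rule degree_le) (auto simp: q_def s)
    show "n \<le> degree q" using cq by (intro le_degree) simp
  qed
  have "q \<noteq> 0" using cq by auto
  then have pos: "poly_ip q q > 0" by (rule poly_ip_pos)
  have orthq: "poly_ip q (p k) = 0" if "k < n" for k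
  proof -
    have "poly_ip s (p k) = (\<Sum>l<n. poly_ip (monom 1 n) (p l) * (if l = k then 1 else 0))"
      unfolding s_def by (simp add: poly_ip_sum_left poly_ip_smult_left orth that)
    also have "\<dots> = poly_ip (monom 1 n) (p k)"
      using that by (simp add: if_distrib cong: if_cong)
    finally show ?thesis by (simp add: q_def poly_ip_diff_left)
  qed
  define a where "a = 1 / sqrt (poly_ip q q)"
  have a: "a > 0" "a * (a * poly_ip q q) = 1"
    using pos by (auto simp: a_def field_simps)
  have "poly_ip (Polynomial.smult a q) (Polynomial.smult a q) = a * (a * poly_ip q q)"
    by (metis poly_ip_smult_left poly_ip_commute)
  then have norm: "poly_ip (Polynomial.smult a q) (Polynomial.smult a q) = 1"
    using a(2) by (rule trans)
  show ?thesis
  proof (intro exI conjI allI impI)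
    show "degree (Polynomial.smult a q) = n" using a(1) dq by simp
    then show "lead_coeff (Polynomial.smult a q) > 0" using a(1) cq by simp
    show "poly_ip (Polynomial.smult a q) (Polynomial.smult a q) = 1" by (rule norm)
    show "poly_ip (Polynomial.smult a q) (p k) = 0" if "k < n" for k
      using orthq[OF that] by (simp add: poly_ip_smult_left)
  qed
qed

lemma legendre_system_exists: "\<exists>p. legendre_system p"
proof -
  define P :: "(nat \<Rightarrow> real poly) \<Rightarrow> nat \<Rightarrow> real poly \<Rightarrow> bool" where
    "P f n q \<longleftrightarrow> degree q = n \<and> lead_coeff q > 0 \<and> poly_ip q q = 1 \<and> (\<forall>k<n. poly_ip q (f k) = 0)"
    for f n q
  have sym: "poly_ip (f k) (f l) = (if k = l then 1 else 0)"
    if "P f k (f k)" "P f l (f l)" for f k l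
  proof (cases k l rule: linorder_cases)
    case less
    then have "poly_ip (f l) (f k) = 0" using that(2) by (simp add: P_def)
    then show ?thesis using less by (simp add: poly_ip_commute)
  next
    case equal
    then show ?thesis using that(1) by (simp add: P_def)
  next
    case greater
    then show ?thesis using that(1) by (simp add: P_def)
  qed
  have "\<exists>f. \<forall>n. P f n (f n)"
  proof (rule dependent_wellorder_choice[where P = P])
    fix r :: "real poly" and f g :: "nat \<Rightarrow> real poly" and n :: nat
    assume "\<And>y. y < n \<Longrightarrow> f y = g y"
    then show "P f n r = P g n r" by (auto simp: P_def)
  next
    fix n :: nat and f :: "nat \<Rightarrow> real poly"
    assume IH: "\<And>y. y < n \<Longrightarrow> P f y (f y)"
    show "\<exists>r. P f n r"
      unfolding P_def
    proof (rule legendre_system_step)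
      show "degree (f k) = k" if "k < n" for k
        using IH[OF that] by (simp add: P_def)
      show "poly_ip (f k) (f l) = (if k = l then 1 else 0)" if "k < n" "l < n" for k l
        using sym[OF IH[OF that(1)] IH[OF that(2)]] .
    qed
  qed
  then obtain f where f: "\<And>n. P f n (f n)" by blast
  have "legendre_system f"
    unfolding legendre_system_def poly_ip_def[symmetric]
  proof (intro conjI allI)
    show "degree (f j) = j" "lead_coeff (f j) > 0" for j
      using f[of j] unfolding P_def by blast+
    show "poly_ip (f j) (f k) = (if j = k then 1 else 0)" for j k
      by (rule sym[OF f f])
  qed
  then show ?thesis by blast
qed

lemma legendre_system_ex1: "\<exists>!p. legendre_system p"
  using legendre_system_exists legendre_system_unique by blast

lemma legendre_system_legendre: "legendre_system legendre"
  unfolding legendre_def using legendre_system_ex1 by (rule theI')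

end

theory Submission
  imports Defs "HOL-Computational_Algebra.Formal_Power_Series"
begin

text \<open>
  Write \<open>J = n - j\<close>. For \<open>i = 0\<close> or \<open>i\<close> odd, row \<open>n - i\<close> is governed by the two products in the
  coefficients of \<open>h\<close>: as a function of \<open>k\<close> they form a polynomial \<open>P\<close> of degree at most \<open>i\<close>
  (\<open>h_factor\<close>). The moment of \<open>t^k\<close> against the \<open>J\<close>-th Legendre polynomial is a ratio of products in
  \<open>k\<close> that vanishes for \<open>k < J\<close> (\<open>shifted_legendre_moment\<close>). Substituting \<open>k = J + l\<close> turns the
  entry into a constant times
  \<open>\<Sum>l\<le>j. (-j)_l (b)_l / (l! (c)_l) P(J + l)\<close> with \<open>b = 2n - i - j + 1\<close> and \<open>c = 2J + 2\<close>
  (\<open>D1_entry_as_hypergeometric_sum\<close>).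

  Everything rests on how this functional acts on polynomials of degree at most \<open>i\<close>. In the Newton
  basis \<open>(y + b)_r\<close> the factor \<open>(b)_l\<close> absorbs the basis element, so each sum is a Chu-Vandermonde
  sum with value proportional to \<open>(i - j + 1 - r)_j\<close>. If \<open>j > i\<close>, this product contains the factor
  0 for every \<open>r \<le> i\<close>, and the entry vanishes (\<open>hypergeometric_sum_vanishes\<close>). If \<open>j \<le> i\<close>,
  evaluating a second Vandermonde sum in the same basis gives a reflection formula
  (\<open>hypergeometric_sum_reflection\<close>): the sum over \<open>l \<le> j\<close> of values at \<open>l\<close> is a sum of the same
  shape over \<open>s \<le> i - j\<close> of values at \<open>-b - s\<close>.

  The reflected nodes are where the polynomial is simple. There the first product becomes
  \<open>(i - s)(i - s - 2)\<dots>(1 - s)\<close>, which vanishes for odd \<open>s \<le> i\<close>, because \<open>i\<close> is odd. Only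
  \<open>s = 2u\<close> survives; halving the Pochhammer symbols \<open>(a)_(2u)\<close> produces the upper parameters in
  pairs, and the values of \<open>P\<close> supply what is left, which is exactly the stated 4F3
  (\<open>reflected_sum_eq_4F3\<close>). The leading value \<open>P\<close> at \<open>s = 0\<close> gives the double factorial and the
  first Pochhammer symbol of \<open>c_coeff\<close>.

  For even \<open>i > 0\<close>, the function in row \<open>n - i\<close> is the one for \<open>n - 1\<close> and the odd index
  \<open>i - 1\<close>, which reduces its entries to that case. In the last column they vanish, because the
  degree of the function is below \<open>n\<close>.
\<close>

section \<open>Products and Pochhammer symbols\<close>

text \<open>
  Both sides are \<open>(b)_(l + r)\<close>. This exchange lets a weight \<open>(b)_l\<close> swallow a Newton basis element
  \<open>(b + l)_r\<close>.
\<close>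

lemma pochhammer_absorb:
  "pochhammer b l * pochhammer (b + real l) r = pochhammer b r * pochhammer (b + real r) l"
  for b :: real
  using pochhammer_product'[of b l r] pochhammer_product'[of b r l] by (simp add: add.commute)

lemma pochhammer_minus_nat:
  assumes "r \<le> m"
  shows "pochhammer (- real m) r = (-1) ^ r * fact m / fact (m - r)"
proof -
  have "pochhammer (- real m) m = pochhammer (- real m) r * pochhammer (- real (m - r)) (m - r)"
    using assms pochhammer_product[of r m "- real m"] by (simp add: of_nat_diff)
  then have "(-1) ^ m * fact m
      = pochhammer (- real m) r * ((-1) ^ (m - r) * fact (m - r))"
    by (simp add: pochhammer_same)
  moreover have "(-1) ^ m = (-1) ^ r * (-1::real) ^ (m - r)"
    using assms by (simp flip: power_add)
  ultimately show ?thesis by (simp add: field_simps)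
qed

lemma pochhammer_Suc_nat: "pochhammer (real m + 1) k = fact (m + k) / fact m"
  using pochhammer_product'[of "1::real" m k]
  by (simp add: field_simps add_ac flip: pochhammer_fact)

lemma falling_product_eq_pochhammer: "(\<Prod>m<J. x - real m) = (-1) ^ J * pochhammer (- x) J"
  by (induction J) (simp_all add: pochhammer_rec' algebra_simps)

text \<open>
  The Legendre moment of \<open>t^k\<close>, up to its constant, at \<open>k = J + l\<close>, the exponents for which it is
  nonzero.
\<close>

lemma falling_product_ratio:
  "(\<Prod>m<J. real (J + l) - real m) / (\<Prod>m\<le>J. real (J + l) + real m + 1)
     = (fact (J + l))\<^sup>2 / (fact l * fact (2 * J + 1 + l))"
proof -
  have 1: "(\<Prod>m<J. real (J + l) - real m) = fact (J + l) / fact l"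
    unfolding falling_product_eq_pochhammer
    by (simp add: pochhammer_minus_nat flip: power_mult_distrib of_nat_add)
  have "(\<Prod>m\<le>J. real (J + l) + real m + 1) = pochhammer (real (J + l) + 1) (Suc J)"
    by (simp only: pochhammer_prod atLeast0LessThan lessThan_Suc_atMost) (simp add: add_ac)
  also have "\<dots> = fact (2 * J + 1 + l) / fact (J + l)"
  proof -
    have "J + l + Suc J = 2 * J + 1 + l" by simp
    then show ?thesis by (simp only: pochhammer_Suc_nat)
  qed
  finally show ?thesis unfolding 1 by (simp add: power2_eq_square del: fact_Suc)
qed

lemma pochhammer_halves:
  "pochhammer z (2 * u) = 4 ^ u * pochhammer (z / 2) u * pochhammer (z / 2 + 1/2) u" for z :: real
proof -
  have "pochhammer (2 * (z / 2)) (2 * u) = 4 ^ u * pochhammer (z / 2) u * pochhammer (z / 2 + 1/2) u"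
    unfolding pochhammer_double by (simp add: power_mult)
  then show ?thesis by simp
qed

lemma fact_double_pochhammer: "fact (2 * u) = 4 ^ u * pochhammer (1/2) u * (fact u :: real)"
  using pochhammer_halves[of 1 u] by (simp flip: pochhammer_fact)

text \<open>
  A product over steps of two, read from its largest factor downwards (here) or from its smallest
  upwards (next). The first reading suits an even shift of \<open>y\<close> downwards, the second a shift upwards,
  since the shift then meets the product at its end.
\<close>

lemma even_step_product_falling:
  "(\<Prod>m<N. y - 2 * real m) = (-2) ^ N * pochhammer (- y / 2) N"
proof (induction N)
  case (Suc N)
  have "y - 2 * real N = (-2) * (- y / 2 + real N)" by simp
  then show ?case
    unfolding prod.lessThan_Suc Suc.IH pochhammer_rec' power_Suc by (simp only: mult_ac)
qed simp

lemma even_step_product_rising: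
  "(\<Prod>m<N. y - 2 * real m) = 2 ^ N * pochhammer (y / 2 - real N + 1) N"
proof -
  have "(-2::real) ^ N * (-1) ^ N = 2 ^ N" by (simp flip: power_mult_distrib)
  moreover have "- y / 2 = - (y / 2)" by simp
  ultimately show ?thesis
    by (simp only: even_step_product_falling pochhammer_minus mult.assoc[symmetric])
qed

lemma even_step_product_shift_down:
  "(\<Prod>m<N. x - 2 * real u - 2 * real m) * pochhammer (- x / 2) u
     = (\<Prod>m<N. x - 2 * real m) * pochhammer (- x / 2 + real N) u"
proof -
  have "pochhammer (- x / 2) u * pochhammer (- x / 2 + real u) N
      = pochhammer (- x / 2) N * pochhammer (- x / 2 + real N) u"
    by (rule pochhammer_absorb)
  moreover have eq: "- (x - 2 * real u) / 2 = - x / 2 + real u" by simp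
  ultimately show ?thesis
    unfolding even_step_product_falling eq by (simp only: mult_ac)
qed

lemma even_step_product_shift_up:
  "(\<Prod>m<N. y + 2 * real u - 2 * real m) * pochhammer (y / 2 - real N + 1) u
     = (\<Prod>m<N. y - 2 * real m) * pochhammer (y / 2 + 1) u"
proof -
  have "pochhammer (y / 2 - real N + 1) u * pochhammer (y / 2 - real N + 1 + real u) N
      = pochhammer (y / 2 - real N + 1) N * pochhammer (y / 2 - real N + 1 + real N) u"
    by (rule pochhammer_absorb)
  moreover have eq: "(y + 2 * real u) / 2 - real N + 1 = y / 2 - real N + 1 + real u"
    by (simp add: add_divide_distrib)
  moreover have "y / 2 - real N + 1 + real N = y / 2 + 1" by simp
  ultimately show ?thesis
    unfolding even_step_product_rising eq by (simp only: mult_ac)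
qed

lemma double_fact_odd: "real (double_fact (2 * h + 1)) = (\<Prod>m<h + 1. real (2 * h + 1) - 2 * real m)"
proof (induction h)
  case (Suc h)
  have a: "(\<Prod>m<Suc h + 1. real (2 * Suc h + 1) - 2 * real m)
      = real (2 * Suc h + 1) * (\<Prod>m<h + 1. real (2 * h + 1) - 2 * real m)"
    by (simp only: prod.lessThan_Suc_shift add_Suc) (simp add: algebra_simps)
  have "2 * Suc h + 1 = Suc (Suc (2 * h + 1))" by simp
  then have b: "real (double_fact (2 * Suc h + 1))
      = real (2 * Suc h + 1) * real (double_fact (2 * h + 1))"
    by (simp only: double_fact.simps of_nat_mult)
  show ?case by (simp only: a b Suc.IH)
qed simp

lemma sum_over_even_indices:
  fixes f :: "nat \<Rightarrow> real"
  assumes "\<And>s. s \<le> M \<Longrightarrow> odd s \<Longrightarrow> f s = 0"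
  shows "(\<Sum>s\<le>M. f s) = (\<Sum>u\<le>M div 2. f (2 * u))"
proof -
  have "(\<Sum>s\<le>M. f s) = (\<Sum>s\<in>{s. s \<le> M \<and> even s}. f s)"
    using assms by (intro sum.mono_neutral_right) auto
  also have "\<dots> = (\<Sum>u\<le>M div 2. f (2 * u))"
    by (intro sum.reindex_bij_witness[of _ "\<lambda>u. 2 * u" "\<lambda>s. s div 2"]) auto
  finally show ?thesis .
qed

section \<open>Moments of the Legendre polynomials\<close>

lemma poly_ip_unit_interval:
  "poly_ip p q = 2 * integral {0..1} (\<lambda>t. poly p (2 * t - 1) * poly q (2 * t - 1))"
proof -
  have "((\<lambda>t. poly p t * poly q t) has_integral poly_ip p q) (cbox (-1) 1)"
    unfolding poly_ip_def cbox_interval by (intro integrable_integral poly_ip_integrable)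
  from has_integral_affinity'[OF this, of 2 "-1"]
  have "((\<lambda>t. poly p (2 * t - 1) * poly q (2 * t - 1)) has_integral poly_ip p q / 2) {0..1}"
    by (simp add: cbox_interval)
  from integral_unique[OF this] show ?thesis by simp
qed

lemma has_integral_monomial:
  "((\<lambda>t::real. t ^ k) has_integral 1 / (real k + 1)) {0..1}"
proof -
  have "((\<lambda>t::real. t ^ k) has_integral 1 ^ Suc k / real (Suc k) - 0 ^ Suc k / real (Suc k)) {0..1}"
  proof (rule fundamental_theorem_of_calculus)
    fix x :: real
    have "((\<lambda>t. t ^ Suc k / real (Suc k)) has_real_derivative x ^ k) (at x within {0..1})"
      by (rule derivative_eq_intros refl | simp del: of_nat_Suc)+
    then show "((\<lambda>t. t ^ Suc k / real (Suc k)) has_vector_derivative x ^ k) (at x within {0..1})"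
      by (simp only: has_real_derivative_iff_has_vector_derivative)
  qed simp
  then show ?thesis by (simp add: add.commute)
qed

lemma integral_power_times_poly:
  "integral {0..1} (\<lambda>t. t ^ k * poly q t) = (\<Sum>l\<le>degree q. coeff q l / (real k + real l + 1))"
proof -
  have "((\<lambda>t. \<Sum>l\<le>degree q. coeff q l * t ^ (k + l))
      has_integral (\<Sum>l\<le>degree q. coeff q l * (1 / (real (k + l) + 1)))) {0..1}"
    by (intro has_integral_sum has_integral_mult_right has_integral_monomial) simp
  then have "((\<lambda>t. t ^ k * poly q t)
      has_integral (\<Sum>l\<le>degree q. coeff q l * (1 / (real (k + l) + 1)))) {0..1}"
    by (simp add: poly_altdef sum_distrib_left power_add mult_ac)
  from integral_unique[OF this] show ?thesis by simp
qed

definition shifted_legendre :: "nat \<Rightarrow> real poly" where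
  "shifted_legendre J = pcompose (legendre J) [:-1, 2:]"

lemma poly_shifted_legendre: "poly (shifted_legendre J) t = poly (legendre J) (2 * t - 1)"
  by (simp add: shifted_legendre_def poly_pcompose algebra_simps)

lemma degree_shifted_legendre: "degree (shifted_legendre J) = J"
  using legendre_system_legendre
  by (simp add: shifted_legendre_def degree_pcompose legendre_system_def)

lemma lead_coeff_shifted_legendre:
  "coeff (shifted_legendre J) J = 2 ^ J * lead_coeff (legendre J)"
  using lead_coeff_comp[of "[:-1, 2:] :: real poly" "legendre J"] legendre_system_legendre
  by (simp add: degree_shifted_legendre flip: shifted_legendre_def)
     (simp add: legendre_system_def)

lemma legendre_orthonormal: "poly_ip (legendre j) (legendre k) = (if j = k then 1 else 0)"
  using legendre_system_legendre by (simp add: legendre_system_def poly_ip_def)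

lemma degree_legendre: "degree (legendre j) = j" and lead_coeff_legendre_pos: "lead_coeff (legendre j) > 0"
  using legendre_system_legendre unfolding legendre_system_def by blast+

lemma legendre_orthogonal_lower:
  assumes "r = 0 \<or> degree r < J"
  shows "poly_ip r (legendre J) = 0"
proof (rule poly_ip_orthogonal_lower[where p = legendre and n = J])
  show "legendre k \<noteq> 0 \<and> degree (legendre k) = k" for k
    using degree_legendre[of k] lead_coeff_legendre_pos[of k] by auto
qed (use assms in \<open>auto simp: legendre_orthonormal\<close>)

lemma moment_as_poly_ip:
  "integral {0..1} (\<lambda>t. t ^ k * poly (shifted_legendre J) t)
     = poly_ip ([:1/2, 1/2:] ^ k) (legendre J) / 2"
  by (simp add: poly_ip_unit_interval poly_shifted_legendre algebra_simps add_divide_distrib)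

lemma moment_eq_0:
  assumes "k < J"
  shows "integral {0..1} (\<lambda>t. t ^ k * poly (shifted_legendre J) t) = 0"
  using assms legendre_orthogonal_lower[of "[:1/2, 1/2:] ^ k" J]
  by (simp add: moment_as_poly_ip degree_power_eq)

text \<open>
  The squared norm of the Legendre polynomial sees only its leading monomial, because the remainder
  has lower degree and is orthogonal to it.
\<close>

lemma moment_normalisation:
  "2 * coeff (shifted_legendre J) J * integral {0..1} (\<lambda>t. t ^ J * poly (shifted_legendre J) t) = 1"
proof -
  define c where "c = coeff (shifted_legendre J) J"
  define r where "r = legendre J - Polynomial.smult c ([:1/2, 1/2:] ^ J)"
  have "coeff ([:1/2, 1/2:] ^ J :: real poly) J = (1/2) ^ J"
    using lead_coeff_power[of "[:1/2, 1/2:] :: real poly" J] by (simp add: degree_power_eq)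
  then have "coeff r J = 0"
    using degree_legendre[of J]
    by (simp add: r_def c_def lead_coeff_shifted_legendre power_divide)
  moreover have "degree r \<le> J"
    unfolding r_def by (intro degree_diff_le) (simp_all add: degree_legendre degree_power_eq)
  ultimately have "r = 0 \<or> degree r < J"
    by (metis leading_coeff_0_iff le_neq_implies_less)
  then have "poly_ip r (legendre J) = 0" by (rule legendre_orthogonal_lower)
  then have "c * poly_ip ([:1/2, 1/2:] ^ J) (legendre J) = 1"
    by (simp add: r_def poly_ip_diff_left poly_ip_smult_left legendre_orthonormal)
  then show ?thesis by (simp add: moment_as_poly_ip c_def)
qed

text \<open>
  As a function of \<open>k\<close>, the moment is \<open>\<Sum>l\<le>J. c_l / (k + l + 1)\<close>, where the \<open>c_l\<close> are the
  coefficients of the shifted polynomial. Over a common denominator its numerator has degree at most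
  \<open>J\<close> and, by orthogonality, the \<open>J\<close> roots \<open>0, \<dots>, J - 1\<close>; hence it is known up to a constant
  \<open>C\<close>. Its value at \<open>-J - 1\<close>, that is, the residue there, expresses \<open>C\<close> through the leading
  coefficient, and the normalisation then fixes \<open>C\<close>.
\<close>

lemma shifted_legendre_moment:
  "integral {0..1} (\<lambda>t. t ^ k * poly (shifted_legendre J) t)
     = sqrt ((2 * real J + 1) / 2)
       * ((\<Prod>m<J. real k - real m) / (\<Prod>m\<le>J. real k + real m + 1))"
proof -
  define q where "q = shifted_legendre J"
  define M where "M = (\<lambda>k::nat. integral {0..1} (\<lambda>t. t ^ k * poly q t))"
  define N where "N = (\<Sum>l\<le>J. Polynomial.smult (coeff q l) (\<Prod>m\<in>{..J} - {l}. [:real m + 1, 1:]))"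
  define R where "R = (\<Prod>m<J. [:- real m, 1:])"
  \<comment> \<open>The constant forced by comparing \<open>N\<close> and \<open>R\<close> at \<open>-J - 1\<close>.\<close>
  define C where "C = coeff q J * (fact J)\<^sup>2 / fact (2 * J)"
  have N: "poly N x = (\<Sum>l\<le>J. coeff q l * (\<Prod>m\<in>{..J} - {l}. x + real m + 1))" for x
    by (simp add: N_def poly_sum poly_prod add_ac)
  have R: "poly R x = (\<Prod>m<J. x - real m)" for x
    by (simp add: R_def poly_prod)
  have pos: "(\<Prod>m\<le>J. real k + real m + 1) > 0" for k
    by (intro prod_pos) auto
  have MN: "M k = poly N (real k) / (\<Prod>m\<le>J. real k + real m + 1)" for k
  proof -
    have "M k = (\<Sum>l\<le>J. coeff q l / (real k + real l + 1))"
      by (simp add: M_def integral_power_times_poly q_def degree_shifted_legendre)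
    also have "\<dots> = (\<Sum>l\<le>J. coeff q l * (\<Prod>m\<in>{..J} - {l}. real k + real m + 1)
                          / (\<Prod>m\<le>J. real k + real m + 1))"
    proof (intro sum.cong refl)
      fix l assume "l \<in> {..J}"
      then have "(\<Prod>m\<le>J. real k + real m + 1)
          = (real k + real l + 1) * (\<Prod>m\<in>{..J} - {l}. real k + real m + 1)"
        by (subst prod.remove[of _ l]) auto
      then show "coeff q l / (real k + real l + 1)
          = coeff q l * (\<Prod>m\<in>{..J} - {l}. real k + real m + 1) / (\<Prod>m\<le>J. real k + real m + 1)"
        using pos[of k] by (simp add: field_simps)
    qed
    finally show ?thesis by (simp add: N sum_divide_distrib)
  qed
  \<comment> \<open>The two sides agree at the \<open>J\<close> roots and at \<open>-J - 1\<close>, where only the summand \<open>l = J\<close> of \<open>N\<close>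
  survives; that is one point more than their degree.\<close>
  have "N = Polynomial.smult C R"
  proof (rule poly_eqI_degree)
    let ?A = "insert (- real J - 1) (real ` {..<J})"
    have "card ?A = J + 1"
      by (subst card_insert_disjoint) (auto simp: card_image)
    moreover have "degree N \<le> J"
      unfolding N_def
    proof (intro degree_sum_le degree_smult_le[THEN order_trans])
      fix l assume "l \<in> {..J}"
      have "degree (\<Prod>m\<in>{..J} - {l}. [:real m + 1, 1:]) \<le> (\<Sum>m\<in>{..J} - {l}. 1)"
        by (intro degree_prod_sum_le[THEN order_trans]) auto
      then show "degree (\<Prod>m\<in>{..J} - {l}. [:real m + 1, 1:]) \<le> J"
        using \<open>l \<in> {..J}\<close> by simp
    qed simp
    moreover have "degree R \<le> J"
      unfolding R_def by (intro degree_prod_sum_le[THEN order_trans]) auto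
    ultimately show "card ?A > degree N" "card ?A > degree (Polynomial.smult C R)"
      by (auto intro: order.strict_trans1)
    fix x assume "x \<in> ?A"
    then consider k where "k < J" "x = real k" | "x = - real J - 1" by auto
    then show "poly N x = poly (Polynomial.smult C R) x"
    proof cases
      case 1
      have "M k = 0" using moment_eq_0[OF 1(1)] by (simp add: M_def q_def)
      then have "poly N x = 0" using MN[of k] pos[of k] 1(2) by simp
      moreover have "poly R x = 0" unfolding R 1(2) using 1(1) by (intro prod_zero) auto
      ultimately show ?thesis by simp
    next
      case 2
      have NJ: "poly N x = coeff q J * (\<Prod>m<J. real m - real J)"
      proof -
        have "(\<Prod>m\<in>{..J} - {l}. x + real m + 1) = 0" if "l < J" for l
          using that 2 by (intro prod_zero) (auto intro!: bexI[of _ J])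
        then have "poly N x = (\<Sum>l\<in>{J}. coeff q l * (\<Prod>m\<in>{..J} - {l}. x + real m + 1))"
          unfolding N by (intro sum.mono_neutral_right) auto
        moreover have "{..J} - {J} = {..<J}" by auto
        ultimately show ?thesis by (simp add: 2)
      qed
      have "(\<Prod>m<J. real m - real J) = pochhammer (- real J) J"
        by (simp add: pochhammer_prod atLeast0LessThan algebra_simps)
      then have 3: "(\<Prod>m<J. real m - real J) = (-1) ^ J * fact J" by (simp add: pochhammer_same)
      have "poly R x = (\<Prod>m<J. (-1) * (real J + 1 + real m))"
        unfolding R by (intro prod.cong) (use 2 in auto)
      also have "\<dots> = (-1) ^ J * pochhammer (real J + 1) J"
        by (simp only: prod.distrib pochhammer_prod atLeast0LessThan) simp
      also have "pochhammer (real J + 1) J = fact (2 * J) / fact J"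
        unfolding pochhammer_Suc_nat by (simp add: mult_2)
      finally show ?thesis by (simp add: NJ 3 C_def power2_eq_square)
    qed
  qed
  then have MC: "M k = C * ((\<Prod>m<J. real k - real m) / (\<Prod>m\<le>J. real k + real m + 1))" for k
    by (simp add: MN R)
  have "(\<Prod>m<J. real J - real m) = fact J"
    by (simp add: fact_prod_rev atLeast0LessThan of_nat_diff)
  moreover have "(\<Prod>m\<le>J. real J + real m + 1) = fact (2 * J + 1) / fact J"
  proof -
    have "(\<Prod>m\<le>J. real J + real m + 1) = pochhammer (real J + 1) (Suc J)"
      by (simp only: pochhammer_prod atLeast0LessThan lessThan_Suc_atMost) (simp add: add_ac)
    moreover have "J + Suc J = 2 * J + 1" by simp
    ultimately show ?thesis by (simp only: pochhammer_Suc_nat)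
  qed
  ultimately have MJ: "C * (fact J)\<^sup>2 = M J * fact (2 * J + 1)"
    by (simp add: MC power2_eq_square del: fact_Suc)
  have "2 * C * (C * fact (2 * J)) = 2 * coeff q J * (C * (fact J)\<^sup>2)"
    by (simp add: C_def)
  also have "\<dots> = 2 * coeff q J * M J * fact (2 * J + 1)"
    unfolding MJ by simp
  also have "2 * coeff q J * M J = 1"
    using moment_normalisation[of J] by (simp add: M_def q_def)
  finally have "2 * C * (C * fact (2 * J)) = fact (2 * J + 1)" by simp
  then have "(2 * C * C) * fact (2 * J) = (2 * real J + 1) * fact (2 * J)"
    by (simp add: algebra_simps)
  then have "2 * C * C = 2 * real J + 1" by (simp only: mult_cancel_right) simp
  then have "C\<^sup>2 = (2 * real J + 1) / 2" by (simp add: power2_eq_square)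
  moreover have "C \<ge> 0"
    using lead_coeff_legendre_pos[of J] by (simp add: C_def q_def lead_coeff_shifted_legendre)
  ultimately have "C = sqrt ((2 * real J + 1) / 2)" by (metis real_sqrt_unique)
  then show ?thesis using MC[of k] by (simp add: M_def q_def)
qed

section \<open>Summation and reflection of terminating hypergeometric sums\<close>

text \<open>
  Splitting off the root \<open>-b\<close> leaves a quotient of lower degree, to be expanded with \<open>b + 1\<close>
  in place of \<open>b\<close>.
\<close>

lemma newton_expansion:
  fixes p :: "real poly"
  assumes "degree p \<le> N"
  shows "\<exists>e. \<forall>y. poly p y = (\<Sum>r\<le>N. e r * pochhammer (y + b) r)"
  using assms
proof (induction N arbitrary: p b)
  case 0
  then obtain a where "p = [:a:]" by (auto elim: degree_eq_zeroE)
  then show ?case by (intro exI[of _ "\<lambda>_. a"]) simp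
next
  case (Suc N)
  define q where "q = synthetic_div p (-b)"
  have "degree q \<le> N" using Suc.prems by (simp add: q_def degree_synthetic_div)
  then obtain e where e: "\<And>y. poly q y = (\<Sum>r\<le>N. e r * pochhammer (y + (b + 1)) r)"
    using Suc.IH[of q "b + 1"] by blast
  have p: "poly p y = poly p (-b) + (y + b) * poly q y" for y
  proof -
    have "p = [:b, 1:] * q + [:poly p (-b):]"
      using synthetic_div_correct'[of "-b" p] by (simp add: q_def)
    then have "poly p y = poly ([:b, 1:] * q + [:poly p (-b):]) y" by simp
    then show ?thesis by (simp add: algebra_simps)
  qed
  define e' where "e' r = (case r of 0 \<Rightarrow> poly p (-b) | Suc s \<Rightarrow> e s)" for r
  have "poly p y = (\<Sum>r\<le>Suc N. e' r * pochhammer (y + b) r)" for y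
    unfolding sum.atMost_Suc_shift
    by (subst p) (simp add: e e'_def pochhammer_rec sum_distrib_left mult_ac add_ac)
  then show ?case by blast
qed

lemma Vandermonde_real:
  fixes b c :: real
  assumes "c > 0"
  shows "(\<Sum>l\<le>j. pochhammer (- real j) l * pochhammer b l / (fact l * pochhammer c l))
     = pochhammer (c - b) j / pochhammer c j"
proof -
  have "\<forall>i\<in>{0..<j}. c \<noteq> - real i" using assms by auto
  from Vandermonde_pochhammer[OF this, of b] show ?thesis
    by (simp add: atMost_atLeast0 mult.commute)
qed

lemma Vandermonde_rising:
  fixes b c :: real
  assumes "c > 0"
  shows "(\<Sum>l\<le>j. pochhammer (- real j) l * pochhammer b l / (fact l * pochhammer c l)
            * pochhammer (real l + b) r)
     = pochhammer b r * pochhammer (c - b - real r) j / pochhammer c j"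
proof -
  have "(\<Sum>l\<le>j. pochhammer (- real j) l * pochhammer b l / (fact l * pochhammer c l)
            * pochhammer (real l + b) r)
     = pochhammer b r *
       (\<Sum>l\<le>j. pochhammer (- real j) l * pochhammer (b + real r) l / (fact l * pochhammer c l))"
    unfolding sum_distrib_left
    by (intro sum.cong refl) (use pochhammer_absorb[of b _ r] in \<open>simp add: field_simps\<close>)
  then show ?thesis by (simp add: Vandermonde_real[OF assms] diff_diff_eq)
qed

text \<open>
  After reflection, the Newton basis element \<open>(y + b)_r\<close> at \<open>y = -b - s\<close> is \<open>(-s)_r\<close>. It kills the
  terms with \<open>s < r\<close>; shifting \<open>s = r + q\<close> leaves a Vandermonde sum.
\<close>

lemma Vandermonde_falling:
  fixes b c :: real
  assumes "c > 0"
  shows "(\<Sum>s\<le>M. pochhammer (- real M) s * pochhammer b s / (fact s * pochhammer c s)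
            * pochhammer (- real s) r)
     = (if r \<le> M then fact M / fact (M - r) * pochhammer b r * pochhammer (c - b) (M - r)
                       / pochhammer c M else 0)"
    (is "sum ?f _ = _")
proof (cases "r \<le> M")
  case False
  then have "?f s = 0" if "s \<in> {..M}" for s
    using that by (simp add: pochhammer_of_nat_eq_0_lemma)
  then have "sum ?f {..M} = 0" by (rule sum.neutral[rule_format])
  then show ?thesis using False by simp
next
  case True
  have "sum ?f {..M} = sum ?f {r..M}"
    by (intro sum.mono_neutral_right) (auto simp: pochhammer_of_nat_eq_0_lemma)
  also have "\<dots> = (\<Sum>q\<le>M - r. ?f (r + q))"
    using True by (intro sum.reindex_bij_witness[of _ "\<lambda>q. r + q" "\<lambda>s. s - r"]) auto
  also have "\<dots> = fact M / fact (M - r) * pochhammer b r / pochhammer c r *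
      (\<Sum>q\<le>M - r. pochhammer (- real (M - r)) q * pochhammer (b + real r) q
                    / (fact q * pochhammer (c + real r) q))"
    unfolding sum_distrib_left
  proof (intro sum.cong refl)
    fix q assume "q \<in> {..M - r}"
    have 1: "pochhammer (- real M) (r + q)
        = (-1) ^ r * fact M / fact (M - r) * pochhammer (- real (M - r)) q"
      using True by (simp add: pochhammer_product' pochhammer_minus_nat of_nat_diff)
    have 2: "pochhammer (- real (r + q)) r = (-1) ^ r * fact (r + q) / fact q"
      by (subst pochhammer_minus_nat) auto
    have 3: "(-1::real) ^ r * (-1) ^ r = 1" by (simp flip: power_mult_distrib)
    have sgn: "((-1::real) ^ r * x) * ((-1) ^ r * y) = x * y" for x y using 3 by (simp add: algebra_simps)
    have "?f (r + q) = ((-1) ^ r * (fact M / fact (M - r) * pochhammer (- real (M - r)) q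
        * (pochhammer b r * pochhammer (b + real r) q)
        / (fact (r + q) * (pochhammer c r * pochhammer (c + real r) q))))
        * ((-1) ^ r * (fact (r + q) / fact q))"
      unfolding 1 2 by (simp add: pochhammer_product')
    also have "\<dots> = fact M / fact (M - r) * pochhammer b r / pochhammer c r *
       (pochhammer (- real (M - r)) q * pochhammer (b + real r) q
                    / (fact q * pochhammer (c + real r) q))"
      unfolding sgn by (simp add: mult_ac)
    finally show "?f (r + q) = \<dots>" .
  qed
  also have "\<dots> = fact M / fact (M - r) * pochhammer b r * pochhammer (c - b) (M - r)
        / (pochhammer c r * pochhammer (c + real r) (M - r))"
    using assms by (subst Vandermonde_real) auto
  also have "pochhammer c r * pochhammer (c + real r) (M - r) = pochhammer c M"
    using True by (simp add: pochhammer_product)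
  finally show ?thesis using True by simp
qed

lemma pochhammer_vanish_window:
  assumes "M < r" "r \<le> M + j"
  shows "pochhammer (real M + 1 - real r) j = 0"
proof -
  have "pochhammer (- real (r - M - 1)) j = 0"
    using assms by (intro pochhammer_of_nat_eq_0_lemma) auto
  then show ?thesis using assms by (simp add: of_nat_diff algebra_simps)
qed

text \<open>
  A discrete counterpart of the substitution \<open>y \<mapsto> -b - y\<close>, under which the roles of \<open>j\<close> and
  \<open>M\<close> are exchanged. On the basis element \<open>(y + b)_r\<close> both sides equal
  \<open>(b)_r (M - r + j)! / (j! (M - r)!)\<close> for \<open>r \<le> M\<close> and vanish for \<open>M < r \<le> M + j\<close>, so the formula
  holds up to degree \<open>M + j\<close>.
\<close>

lemma hypergeometric_sum_reflection:
  fixes Q :: "real poly" and b :: real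
  assumes deg: "degree Q \<le> M + j" and b: "b > 0"
  shows "pochhammer (b + real M + 1) j / fact j *
      (\<Sum>l\<le>j. pochhammer (- real j) l * pochhammer b l / (fact l * pochhammer (b + real M + 1) l)
            * poly Q (real l))
   = pochhammer (b + real j + 1) M / fact M *
      (\<Sum>s\<le>M. pochhammer (- real M) s * pochhammer b s / (fact s * pochhammer (b + real j + 1) s)
            * poly Q (- b - real s))"
    (is "?A * (\<Sum>l\<le>j. ?u l * _) = ?B * (\<Sum>s\<le>M. ?v s * _)")
proof -
  obtain e where e: "\<And>y. poly Q y = (\<Sum>r\<le>M + j. e r * pochhammer (y + b) r)"
    using newton_expansion[OF deg, of b] by blast
  have swap: "(\<Sum>l\<in>S. w l * (\<Sum>r\<le>M + j. e r * f l r)) = (\<Sum>r\<le>M + j. e r * (\<Sum>l\<in>S. w l * f l r))"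
    for S :: "nat set" and w :: "nat \<Rightarrow> real" and f
    unfolding sum_distrib_left by (subst sum.swap) (simp add: mult_ac)
  have basis: "?A * (\<Sum>l\<le>j. ?u l * pochhammer (real l + b) r)
      = ?B * (\<Sum>s\<le>M. ?v s * pochhammer (- real s) r)" if r: "r \<le> M + j" for r
  proof (cases "r \<le> M")
    case True
    have A: "?A * (\<Sum>l\<le>j. ?u l * pochhammer (real l + b) r)
        = pochhammer b r * pochhammer (real (M - r) + 1) j / fact j"
    proof -
      have "pochhammer (b + real M + 1) j \<noteq> 0"
        using b by (intro less_imp_neq[symmetric] pochhammer_pos) linarith
      then show ?thesis using True b
        by (subst Vandermonde_rising) (simp_all add: of_nat_diff algebra_simps)
    qed
    have B: "?B * (\<Sum>s\<le>M. ?v s * pochhammer (- real s) r)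
        = pochhammer b r * pochhammer (real j + 1) (M - r) / fact (M - r)"
    proof -
      have "pochhammer (b + real j + 1) M \<noteq> 0"
        using b by (intro less_imp_neq[symmetric] pochhammer_pos) linarith
      then show ?thesis using True b
        by (subst Vandermonde_falling) (simp_all add: algebra_simps)
    qed
    show ?thesis unfolding A B pochhammer_Suc_nat by (simp add: add.commute)
  next
    case False
    have "(\<Sum>l\<le>j. ?u l * pochhammer (real l + b) r) = 0"
    proof -
      have "b + real M + 1 - b - real r = real M + 1 - real r" by simp
      then show ?thesis
        using False r b by (subst Vandermonde_rising) (simp_all add: pochhammer_vanish_window)
    qed
    moreover have "(\<Sum>s\<le>M. ?v s * pochhammer (- real s) r) = 0"
      using False b by (subst Vandermonde_falling) simp_all
    ultimately show ?thesis by simp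
  qed
  have "?A * (\<Sum>l\<le>j. ?u l * poly Q (real l))
      = (\<Sum>r\<le>M + j. e r * (?A * (\<Sum>l\<le>j. ?u l * pochhammer (real l + b) r)))"
    by (simp only: e swap) (simp add: sum_distrib_left mult_ac)
  also have "\<dots> = (\<Sum>r\<le>M + j. e r * (?B * (\<Sum>s\<le>M. ?v s * pochhammer (- real s) r)))"
    by (intro sum.cong refl) (simp only: basis atMost_iff)
  also have "\<dots> = ?B * (\<Sum>s\<le>M. ?v s * poly Q (- b - real s))"
  proof -
    have "poly Q (- b - real s) = (\<Sum>r\<le>M + j. e r * pochhammer (- real s) r)" for s
      by (simp add: e)
    then show ?thesis
      by (simp only: swap) (simp add: sum_distrib_left mult_ac)
  qed
  finally show ?thesis .
qed

text \<open>
  Every basis element \<open>(y + b)_r\<close> with \<open>r \<le> i\<close> contributes the factor \<open>(i + 1 - j - r)_j\<close>, a product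
  of \<open>j\<close> consecutive integers running from at most 0 to at least 0.
\<close>

lemma hypergeometric_sum_vanishes:
  fixes Q :: "real poly" and b c :: real
  assumes deg: "degree Q \<le> i" and ij: "i < j" and c: "c > 0" "c = b + real i + 1 - real j"
  shows "(\<Sum>l\<le>j. pochhammer (- real j) l * pochhammer b l / (fact l * pochhammer c l)
            * poly Q (real l)) = 0"
proof -
  obtain e where e: "\<And>y. poly Q y = (\<Sum>r\<le>i. e r * pochhammer (y + b) r)"
    using newton_expansion[OF deg, of b] by blast
  have "(\<Sum>l\<le>j. pochhammer (- real j) l * pochhammer b l / (fact l * pochhammer c l)
            * poly Q (real l))
      = (\<Sum>r\<le>i. e r * (\<Sum>l\<le>j. pochhammer (- real j) l * pochhammer b l
            / (fact l * pochhammer c l) * pochhammer (real l + b) r))"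
    unfolding e sum_distrib_left by (subst sum.swap) (simp add: mult_ac)
  also have "\<dots> = 0"
  proof (intro sum.neutral ballI)
    fix r assume r: "r \<in> {..i}"
    have "pochhammer (- real (j + r - i - 1)) j = 0"
      using r ij by (intro pochhammer_of_nat_eq_0_lemma) auto
    moreover have "c - b - real r = - real (j + r - i - 1)"
      using r ij c by (simp add: of_nat_diff)
    ultimately show "e r * (\<Sum>l\<le>j. pochhammer (- real j) l * pochhammer b l
            / (fact l * pochhammer c l) * pochhammer (real l + b) r) = 0"
      by (simp only: Vandermonde_rising[OF c(1)] mult_zero_right div_0)
  qed
  finally show ?thesis .
qed

section \<open>Matrix entries as hypergeometric sums\<close>

text \<open>
  The two products in \<open>d_coeff\<close> as a polynomial in the summation index \<open>k\<close>, so that it can also be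
  evaluated at the negative arguments to which the reflection leads.
\<close>

definition h_factor :: "nat \<Rightarrow> nat \<Rightarrow> real poly" where
  "h_factor n i = (\<Prod>m<(i + 1) div 2. [:real n + 1 - 2 * real m, 1:])
                * (\<Prod>m<i div 2. [:real n - 1 - 2 * real m, -1:])"

lemma poly_h_factor:
  "poly (h_factor n i) x = (\<Prod>m<(i + 1) div 2. real n + x + 1 - 2 * real m)
                * (\<Prod>m<i div 2. real n - x - 1 - 2 * real m)"
  unfolding h_factor_def poly_mult poly_prod
  by (intro arg_cong2[where f = "(*)"] prod.cong refl) simp_all

lemma degree_h_factor: "degree (h_factor n i) \<le> i"
proof -
  have "degree (\<Prod>m<(i + 1) div 2. [:real n + 1 - 2 * real m, 1:]) \<le> (i + 1) div 2"
    by (intro degree_prod_sum_le[THEN order_trans]) auto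
  moreover have "degree (\<Prod>m<i div 2. [:real n - 1 - 2 * real m, -1:]) \<le> i div 2"
    by (intro degree_prod_sum_le[THEN order_trans]) auto
  ultimately have "degree (h_factor n i) \<le> (i + 1) div 2 + i div 2"
    unfolding h_factor_def by (intro degree_mult_le[THEN order_trans] add_mono)
  then show ?thesis by presburger
qed

lemma h_fun_zero_or_odd_index:
  assumes "i \<le> n" "i = 0 \<or> odd i"
  shows "h_fun n (n - i) = (\<lambda>t. \<Sum>k\<in>{0..n}. d_coeff n i k * t ^ k)"
proof -
  have "n - (n - i) = i" using assms by simp
  then show ?thesis using assms(2) by (simp add: h_fun_def fun_eq_iff Let_def)
qed

lemma h_fun_even_index:
  assumes "i \<le> n" "even i" "0 < i"
  shows "h_fun n (n - i) = (\<lambda>t. \<Sum>k\<in>{0..n - 1}. d_coeff (n - 1) (i - 1) k * t ^ k)"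
proof -
  have "n - (n - i) = i" using assms by simp
  then show ?thesis using assms(2,3) by (simp add: h_fun_def fun_eq_iff Let_def)
qed

lemma integral_sum_times_legendre:
  "integral {0..1} (\<lambda>t. (\<Sum>k\<in>{0..N}. d k * t ^ k) * poly (legendre J) (2 * t - 1))
    = (\<Sum>k\<in>{0..N}. d k * integral {0..1} (\<lambda>t. t ^ k * poly (shifted_legendre J) t))"
proof -
  have "((\<lambda>t. \<Sum>k\<in>{0..N}. d k * (t ^ k * poly (shifted_legendre J) t)) has_integral
     (\<Sum>k\<in>{0..N}. d k * integral {0..1} (\<lambda>t. t ^ k * poly (shifted_legendre J) t))) {0..1}"
    by (intro has_integral_sum has_integral_mult_right integrable_integral
        integrable_continuous_interval continuous_intros) simp
  from integral_unique[OF this] show ?thesis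
    by (simp add: poly_shifted_legendre sum_distrib_left sum_distrib_right mult_ac)
qed

lemma integral_legendre_eq_0:
  assumes "N < J"
  shows "integral {0..1} (\<lambda>t. (\<Sum>k\<in>{0..N}. d k * t ^ k) * poly (legendre J) (2 * t - 1)) = 0"
  unfolding integral_sum_times_legendre
  by (intro sum.neutral ballI) (use assms in \<open>simp add: moment_eq_0\<close>)

text \<open>
  With \<open>k = J + l\<close> each symbol \<open>(a)_k\<close> splits as \<open>(a)_J (a + J)_l\<close>. The first factors move into
  the constant, and the factorials \<open>k!\<close> cancel against those in the moment.
\<close>

lemma D1_entry_as_hypergeometric_sum:
  assumes ij: "i \<le> n" "j \<le> n" and i: "i = 0 \<or> odd i"
  shows "D1 n $$ (n - i, n - j)
    = 2 * sqrt ((2 * real (n - j) + 1) / 2) * (-1) ^ n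
      * (sqrt (2 * real n - 2 * real i + 1) / pochhammer (- real n) i)
      * (pochhammer (- real n) (n - j) * pochhammer (real (n - i) + 1) (n - j) / fact (2 * (n - j) + 1))
      * (\<Sum>l\<le>j. pochhammer (- real j) l * pochhammer (2 * real n - real i - real j + 1) l
            / (fact l * pochhammer (2 * real (n - j) + 2) l)
            * poly (h_factor n i) (real (n - j) + real l))"
    (is "_ = ?K * ?L * ?A * (\<Sum>l\<le>j. ?s l)")
proof -
  define J where "J = n - j"
  have n: "n = J + j" using ij by (simp add: J_def)
  let ?m = "\<lambda>k. integral {0..1} (\<lambda>t. t ^ k * poly (shifted_legendre J) t)"
  have "D1 n $$ (n - i, n - j) = 2 * (\<Sum>k\<in>{0..n}. d_coeff n i k * ?m k)"
    using ij by (simp add: D1_def h_fun_zero_or_odd_index[OF ij(1) i] J_def integral_sum_times_legendre)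
  also have "(\<Sum>k\<in>{0..n}. d_coeff n i k * ?m k) = (\<Sum>k\<in>{J..n}. d_coeff n i k * ?m k)"
    by (intro sum.mono_neutral_right) (auto simp: moment_eq_0)
  also have "\<dots> = (\<Sum>l\<le>j. d_coeff n i (J + l) * ?m (J + l))"
    using n by (intro sum.reindex_bij_witness[of _ "\<lambda>q. J + q" "\<lambda>s. s - J"]) auto
  also have "2 * \<dots> = (\<Sum>l\<le>j. ?K * ?L * ?A * ?s l)"
    unfolding sum_distrib_left
  proof (intro sum.cong refl)
    fix l
    have p1: "pochhammer (- real n) (J + l) = pochhammer (- real n) J * pochhammer (- real j) l"
      using pochhammer_product'[of "- real n" J l] by (simp add: n)
    have p2: "pochhammer (real n - real i + 1) (J + l) = pochhammer (real (n - i) + 1) J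
        * pochhammer (2 * real n - real i - real j + 1) l"
      using pochhammer_product'[of "real n - real i + 1" J l] ij n
      by (simp add: of_nat_diff algebra_simps)
    have p3: "fact (2 * J + 1 + l) = fact (2 * J + 1) * pochhammer (2 * real J + 2) l"
      using pochhammer_Suc_nat[of "2 * J + 1" l] by (simp add: field_simps del: fact_Suc)
    have cancel: "a * (x / F) * P * (r * (F / g)) = a * x * P * (r / g)" if "F \<noteq> 0" for a x F P r g :: real
      using that by simp
    have "d_coeff n i (J + l) * ?m (J + l)
       = (-1) ^ n * (sqrt (2 * real n - 2 * real i + 1) / pochhammer (- real n) i)
     * (pochhammer (- real n) (J + l) * pochhammer (real n - real i + 1) (J + l) / (fact (J + l))\<^sup>2)
     * poly (h_factor n i) (real J + real l) * (sqrt ((2 * real J + 1) / 2)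
       * ((fact (J + l))\<^sup>2 / (fact l * fact (2 * J + 1 + l))))"
      unfolding shifted_legendre_moment falling_product_ratio d_coeff_def poly_h_factor
      by (simp add: power2_eq_square add_ac mult.assoc flip: pochhammer_fact)
    also have "\<dots> = (-1) ^ n * (sqrt (2 * real n - 2 * real i + 1) / pochhammer (- real n) i)
     * (pochhammer (- real n) (J + l) * pochhammer (real n - real i + 1) (J + l))
     * poly (h_factor n i) (real J + real l) * (sqrt ((2 * real J + 1) / 2)
       / (fact l * fact (2 * J + 1 + l)))"
      by (rule cancel) simp
    finally show "2 * (d_coeff n i (J + l) * ?m (J + l)) = ?K * ?L * ?A * ?s l"
      unfolding p1 p2 p3 J_def[symmetric]
      by (simp only: divide_inverse inverse_mult_distrib mult_ac)
  qed
  finally show ?thesis by (simp only: sum_distrib_left)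
qed

section \<open>The reflected sum as a 4F3 series\<close>

text \<open>
  At the reflected node with index \<open>s\<close>, the first product is \<open>(i - s)(i - s - 2)\<dots>(1 - s)\<close>, which
  passes through 0 when \<open>i - s\<close> is even.
\<close>

lemma h_factor_reflected_odd:
  assumes "odd i" "odd s" "s \<le> i"
  shows "poly (h_factor n i) (real i - real n - 1 - real s) = 0"
proof -
  obtain p q where pq: "i = 2 * p + 1" "s = 2 * q + 1" "q \<le> p"
    using assms by (auto elim!: oddE)
  have "(\<Prod>m<(i + 1) div 2. real n + (real i - real n - 1 - real s) + 1 - 2 * real m) = 0"
    by (rule prod_zero) (use pq in \<open>auto simp: of_nat_diff intro!: bexI[of _ "p - q"]\<close>)
  then show ?thesis by (simp add: poly_h_factor)
qed

text \<open>
  Passing from \<open>s = 0\<close> to \<open>s = 2u\<close> shifts the first product down and the second one up; each shift is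
  a quotient of Pochhammer symbols. They account for the lower parameters \<open>-i/2\<close> and
  \<open>n - i + 3/2\<close> of the 4F3.
\<close>

lemma h_factor_reflected_even:
  assumes "odd i"
  shows "poly (h_factor n i) (real i - real n - 1 - real (2 * u))
       * (pochhammer (- real i / 2) u * pochhammer (real n - real i + 3/2) u)
     = poly (h_factor n i) (real i - real n - 1)
       * (pochhammer (1/2) u * pochhammer (real n - real i / 2 + 1) u)"
proof -
  obtain h where i: "i = 2 * h + 1" using assms by (elim oddE)
  have red: "poly (h_factor n i) (real i - real n - 1 - real (2 * u))
     = (\<Prod>m<h + 1. real i - 2 * real u - 2 * real m)
       * (\<Prod>m<h. (2 * real n - real i) + 2 * real u - 2 * real m)" for u
    unfolding poly_h_factor i by (intro arg_cong2[where f = "(*)"] prod.cong) (simp_all add: algebra_simps)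
  have a: "- real i / 2 + real (h + 1) = 1/2"
    "(2 * real n - real i) / 2 - real h + 1 = real n - real i + 3/2"
    "(2 * real n - real i) / 2 + 1 = real n - real i / 2 + 1"
    by (simp_all add: i field_simps)
  show ?thesis
    using even_step_product_shift_down[where x = "real i" and N = "h + 1" and u = u]
      even_step_product_shift_up[where y = "2 * real n - real i" and N = h and u = u]
    unfolding a red using red[of 0] by (simp add: ac_simps)
qed

lemma h_factor_reflected_0:
  assumes i: "odd i"
  shows "poly (h_factor n i) (real i - real n - 1)
    = real (double_fact i) * 2 ^ ((i - 1) div 2) * pochhammer (real n - real i + 3/2) ((i - 1) div 2)"
proof -
  obtain h where i: "i = 2 * h + 1" using assms by (elim oddE)
  have red: "poly (h_factor n i) (real i - real n - 1)
     = (\<Prod>m<h + 1. real i - 2 * real m) * (\<Prod>m<h. (2 * real n - real i) - 2 * real m)"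
    unfolding poly_h_factor i by (intro arg_cong2[where f = "(*)"] prod.cong) (simp_all add: algebra_simps)
  have ff: "real (double_fact i) = (\<Prod>m<h + 1. real i - 2 * real m)"
    unfolding i by (rule double_fact_odd)
  have "(2 * real n - real i) / 2 - real h + 1 = real n - real i + 3/2"
    by (simp add: i field_simps)
  then have up: "(\<Prod>m<h. (2 * real n - real i) - 2 * real m)
      = 2 ^ h * pochhammer (real n - real i + 3/2) h"
    using even_step_product_rising[of "2 * real n - real i" h] by simp
  have "(i - 1) div 2 = h" by (simp add: i)
  then show ?thesis by (simp only: red ff up mult.assoc)
qed

text \<open>
  The first two upper parameters come from halving one Pochhammer symbol \<open>(-M)_(2u)\<close>, which is why the series
  stops at \<open>M div 2\<close> for either parity of \<open>M\<close>.
\<close>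

lemma hypergeometric_4F3_terminating:
  "hypergeometric_4F3 (- real M / 2) (- real M / 2 + 1/2) a3 a4 b1 b2 b3 1
    = (\<Sum>u\<le>M div 2. pochhammer (- real M / 2) u * pochhammer (- real M / 2 + 1/2) u
         * pochhammer a3 u * pochhammer a4 u
         / (pochhammer b1 u * pochhammer b2 u * pochhammer b3 u * fact u))"
proof -
  have "pochhammer (- real M / 2) u * pochhammer (- real M / 2 + 1/2) u = 0" if "M div 2 < u" for u
  proof -
    have "pochhammer (2 * (- real M / 2)) (2 * u) = 0"
      using that by (simp add: pochhammer_of_nat_eq_0_lemma)
    then show ?thesis unfolding pochhammer_double by simp
  qed
  then show ?thesis
    unfolding hypergeometric_4F3_def by (subst suminf_finite[of "{..M div 2}"]) auto
qed

text \<open>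
  All four symbols of index \<open>2u\<close> split into halves. The halves \<open>(1/2)_u\<close> of \<open>(2u)!\<close> and
  \<open>(n - i/2 + 1)_u\<close> of the denominator cancel against the numerators of
  \<open>h_factor_reflected_even\<close>, and the remaining symbols are those of the 4F3.
\<close>

lemma reflected_sum_eq_4F3:
  assumes i: "odd i" "j \<le> i" "i \<le> n"
  defines "b \<equiv> 2 * real n - real i - real j + 1"
  shows "(\<Sum>s\<le>i - j. pochhammer (- real (i - j)) s * pochhammer b s
            / (fact s * pochhammer (b + real j + 1) s)
            * poly (h_factor n i) (real i - real n - 1 - real s))
    = poly (h_factor n i) (real i - real n - 1) *
      hypergeometric_4F3
              (- (real i - real j) / 2) ((real j - real i + 1) / 2)
              (real n - (real i + real j - 1) / 2) (real n - (real i + real j) / 2 + 1)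
              (real n - real i / 2 + 3/2) (- real i / 2) (real n - real i + 3/2) 1"
    (is "sum ?f _ = ?P * hypergeometric_4F3 ?a1 ?a2 ?a3 ?a4 ?b1 ?b2 ?b3 1")
proof -
  define M where "M = i - j"
  have a12: "?a1 = - real M / 2" "?a2 = - real M / 2 + 1/2"
    using i by (simp_all add: M_def of_nat_diff field_simps)
  have "sum ?f {..M} = (\<Sum>u\<le>M div 2. ?f (2 * u))"
    using i by (intro sum_over_even_indices) (simp add: M_def h_factor_reflected_odd)
  also have "\<dots> = ?P * hypergeometric_4F3 ?a1 ?a2 ?a3 ?a4 ?b1 ?b2 ?b3 1"
    unfolding a12 hypergeometric_4F3_terminating sum_distrib_left
  proof (intro sum.cong refl)
    fix u
    have p1: "pochhammer (- real M) (2 * u)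
        = 4 ^ u * pochhammer (- real M / 2) u * pochhammer (- real M / 2 + 1/2) u"
      by (rule pochhammer_halves)
    have p2: "pochhammer b (2 * u) = 4 ^ u * pochhammer ?a3 u * pochhammer ?a4 u"
    proof -
      have "b / 2 = ?a3" "b / 2 + 1/2 = ?a4" by (simp_all add: b_def field_simps)
      then show ?thesis using pochhammer_halves[of b u] by (simp only:)
    qed
    have p3: "pochhammer (b + real j + 1) (2 * u)
        = 4 ^ u * pochhammer (real n - real i / 2 + 1) u * pochhammer ?b1 u"
    proof -
      have "(b + real j + 1) / 2 = real n - real i / 2 + 1"
        "(b + real j + 1) / 2 + 1/2 = ?b1" by (simp_all add: b_def field_simps)
      then show ?thesis using pochhammer_halves[of "b + real j + 1" u] by (simp only:)
    qed
    have nz: "pochhammer (1/2 :: real) u > 0" "pochhammer (real n - real i / 2 + 1) u > 0"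
       "pochhammer ?b3 u > 0" "pochhammer ?b1 u > 0"
      using i(3) by (auto intro!: pochhammer_pos simp: field_simps)
    have nz2: "pochhammer ?b2 u \<noteq> 0"
    proof
      assume "pochhammer ?b2 u = 0"
      then obtain k where "- real i / 2 = - real k" by (auto simp: pochhammer_eq_0_iff)
      then have "real i = real (2 * k)" by simp
      then have "i = 2 * k" by (simp only: of_nat_eq_iff)
      then show False using i(1) by simp
    qed
    have "poly (h_factor n i) (real i - real n - 1 - real (2 * u))
      = ?P * (pochhammer (1/2) u * pochhammer (real n - real i / 2 + 1) u)
        / (pochhammer ?b2 u * pochhammer ?b3 u)"
      using h_factor_reflected_even[OF i(1), of n u] nz nz2 by (simp add: field_simps)
    then show "?f (2 * u) = ?P * (pochhammer (- real M / 2) u * pochhammer (- real M / 2 + 1/2) u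
         * pochhammer ?a3 u * pochhammer ?a4 u
         / (pochhammer ?b1 u * pochhammer ?b2 u * pochhammer ?b3 u * fact u))"
      unfolding M_def[symmetric] p1 p2 p3 fact_double_pochhammer using nz nz2 by (simp add: mult_ac)
  qed
  finally show ?thesis by (simp only: M_def)
qed

section \<open>The entries of the matrix\<close>

lemma D1_zero_outside_band:
  assumes "i \<le> n" "j \<le> n" "i = 0 \<or> odd i" "i < j"
  shows "D1 n $$ (n - i, n - j) = 0"
proof -
  have "(\<Sum>l\<le>j. pochhammer (- real j) l * pochhammer (2 * real n - real i - real j + 1) l
            / (fact l * pochhammer (2 * real (n - j) + 2) l)
            * poly (pcompose (h_factor n i) [:real (n - j), 1:]) (real l)) = 0"
    using assms degree_h_factor[of n i]
    by (intro hypergeometric_sum_vanishes[of _ i]) (auto simp: degree_pcompose of_nat_diff)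
  then show ?thesis
    using assms by (simp add: D1_entry_as_hypergeometric_sum poly_pcompose)
qed

lemma D1_corner: "D1 n $$ (n, n) = sqrt 2"
proof -
  have "D1 n $$ (n, n) = 2 * (sqrt ((2 * real n + 1) / 2) * sqrt (2 * real n + 1))
      * ((-1) ^ n * pochhammer (- real n) n * pochhammer (real n + 1) n / fact (2 * n + 1))"
    using D1_entry_as_hypergeometric_sum[of 0 n 0] by (simp add: poly_h_factor del: fact_Suc)
  also have "(-1) ^ n * pochhammer (- real n) n = fact n"
    by (simp add: pochhammer_same flip: power_mult_distrib)
  also have "sqrt ((2 * real n + 1) / 2) * sqrt (2 * real n + 1) = (2 * real n + 1) / sqrt 2"
    by (simp add: real_sqrt_divide)
  also have "fact n * pochhammer (real n + 1) n / fact (2 * n + 1) = 1 / (2 * real n + 1)"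
  proof -
    have 1: "fact (2 * n + 1) = (2 * real n + 1) * fact (2 * n)" by (simp add: algebra_simps)
    have 2: "pochhammer (real n + 1) n = fact (2 * n) / fact n"
      unfolding pochhammer_Suc_nat by (simp add: mult_2)
    show ?thesis unfolding 1 2 by simp
  qed
  also have "2 * ((2 * real n + 1) / sqrt 2) * (1 / (2 * real n + 1)) = 2 / sqrt 2"
  proof -
    have "2 * (x / s) * (1 / x) = 2 / s" if "x \<noteq> 0" for x s :: real using that by simp
    moreover have "2 * real n + 1 \<noteq> 0" by linarith
    ultimately show ?thesis by blast
  qed
  finally have "D1 n $$ (n, n) = 2 / sqrt 2" .
  then show ?thesis by (simp add: real_div_sqrt)
qed

text \<open>
  The reflection is applied with \<open>M = i - j\<close> and \<open>b = 2n - i - j + 1\<close>; the rest of the proof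
  matches the constants by writing them all as factorials.
\<close>

lemma D1_odd_row:
  assumes i: "odd i" "j \<le> i" "i \<le> n"
  shows "D1 n $$ (n - i, n - j) =
          c_coeff n i j * (-1) ^ (n + j)
          * sqrt (2 * (real n - real i) + 1) * sqrt (2 * (real n - real j) + 1)
          * hypergeometric_4F3
              (- (real i - real j) / 2) ((real j - real i + 1) / 2)
              (real n - (real i + real j - 1) / 2) (real n - (real i + real j) / 2 + 1)
              (real n - real i / 2 + 3/2) (- real i / 2) (real n - real i + 3/2) 1"
    (is "_ = _ * ?F")
proof -
  define M where "M = i - j"
  define a where "a = n - i"
  define J where "J = n - j"
  define h where "h = (i - 1) div 2"
  define b where "b = 2 * real n - real i - real j + 1"
  have nat: "i = j + M" "n = j + M + a" "J = M + a" "i = 2 * h + 1"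
    using i by (auto simp: M_def a_def J_def h_def)
  define S where "S = (\<Sum>l\<le>j. pochhammer (- real j) l * pochhammer b l
            / (fact l * pochhammer (2 * real J + 2) l)
            * poly (h_factor n i) (real J + real l))"
  have bM: "b + real M + 1 = 2 * real J + 2" and bj: "b + real j + 1 = real (2 * a + j + M + 1) + 1"
    by (simp_all add: b_def nat(1-3))
  have cancel: "S / F = x / (y * F') * R"
    if "G / F / x * S = G / F' / y * R" "G \<noteq> 0" "F \<noteq> 0" "x \<noteq> 0" "F' \<noteq> 0" "y \<noteq> 0"
    for G F x F' y S R :: real
    using that by (simp add: field_simps)
  have "pochhammer (b + real M + 1) j / fact j *
      (\<Sum>l\<le>j. pochhammer (- real j) l * pochhammer b l / (fact l * pochhammer (b + real M + 1) l)
            * poly (pcompose (h_factor n i) [:real J, 1:]) (real l))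
   = pochhammer (b + real j + 1) M / fact M *
      (\<Sum>s\<le>M. pochhammer (- real M) s * pochhammer b s / (fact s * pochhammer (b + real j + 1) s)
            * poly (pcompose (h_factor n i) [:real J, 1:]) (- b - real s))"
    by (rule hypergeometric_sum_reflection)
       (use degree_h_factor[of n i] in \<open>simp_all add: degree_pcompose nat(1) b_def nat(2)\<close>)
  moreover have "poly (pcompose (h_factor n i) [:real J, 1:]) (- b - real s)
      = poly (h_factor n i) (real i - real n - 1 - real s)" for s
  proof -
    have "poly [:real J, 1:] (- b - real s) = real i - real n - 1 - real s"
      by (simp add: b_def nat(1-3))
    then show ?thesis by (simp only: poly_pcompose)
  qed
  moreover have "poly (pcompose (h_factor n i) [:real J, 1:]) (real l)
      = poly (h_factor n i) (real J + real l)" for l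
    by (simp add: poly_pcompose)
  ultimately have "pochhammer (2 * real J + 2) j / fact j * S
     = pochhammer (b + real j + 1) M / fact M * (poly (h_factor n i) (real i - real n - 1) * ?F)"
    using reflected_sum_eq_4F3[OF i] unfolding S_def bM by (simp only: b_def M_def)
  moreover have "pochhammer (2 * real J + 2) j = fact (2 * J + 1 + j) / fact (2 * J + 1)"
    using pochhammer_Suc_nat[of "2 * J + 1" j] by (simp del: fact_Suc add: add_ac)
  moreover have "pochhammer (b + real j + 1) M = fact (2 * J + 1 + j) / fact (2 * n - i + 1)"
    unfolding bj pochhammer_Suc_nat by (simp del: fact_Suc add: nat(1-3) algebra_simps)
  ultimately have S: "S / fact (2 * J + 1) = fact j / (fact M * fact (2 * n - i + 1))
      * (poly (h_factor n i) (real i - real n - 1) * ?F)"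
    using cancel[of "fact (2 * J + 1 + j)" "fact (2 * J + 1)" "fact j" S "fact (2 * n - i + 1)" "fact M"]
    by (simp only: fact_nonzero not_False_eq_True simp_thms)
  have two: "2 powr (real i / 2) = sqrt 2 * 2 ^ h"
    by (simp add: nat(4) add_divide_distrib powr_add powr_half_sqrt powr_realpow)
  have s2: "2 * sqrt ((2 * real J + 1) / 2) = sqrt 2 * sqrt (2 * real J + 1)"
    by (simp add: real_sqrt_divide field_simps)
  have sgn: "(-1::real) ^ n * ((-1) ^ J / (-1) ^ i) = (-1) ^ (n + j) * (-1) ^ a"
    by (cases "even j"; cases "even M"; cases "even a") (simp_all add: nat(1-3) power_add)
  have q1: "pochhammer (- real n) i = (-1) ^ i * fact n / fact a"
    using i by (simp add: pochhammer_minus_nat a_def)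
  have q2: "pochhammer (- real n) J = (-1) ^ J * fact n / fact j"
    using i by (simp add: pochhammer_minus_nat J_def)
  have q3: "pochhammer (real a + 1) J = fact (a + J) / fact a" by (rule pochhammer_Suc_nat)
  have q4: "pochhammer (- real n + real j) (n - i) = (-1) ^ a * fact J / fact M"
    using pochhammer_minus_nat[of a J] by (simp add: nat(1-3))
  have q5: "pochhammer (real n - real j + 1) (n - i) = fact (a + J) / fact J"
    using pochhammer_Suc_nat[of J a] by (simp add: nat(1-3) add_ac)
  have "D1 n $$ (n - i, n - j) = 2 * sqrt ((2 * real J + 1) / 2) * (-1) ^ n
      * (sqrt (2 * real n - 2 * real i + 1) / pochhammer (- real n) i)
      * (pochhammer (- real n) J * pochhammer (real a + 1) J / fact (2 * J + 1)) * S"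
    using i unfolding S_def b_def by (subst D1_entry_as_hypergeometric_sum) (auto simp: J_def a_def)
  also have "\<dots> = sqrt 2 * sqrt (2 * real J + 1) * sqrt (2 * real n - 2 * real i + 1)
      * ((-1) ^ n * ((-1) ^ J / (-1) ^ i)) * (fact (a + J) / fact j) * (S / fact (2 * J + 1))"
    unfolding s2 q1 q2 q3 by (simp add: mult_ac del: fact_Suc)
  also have "\<dots> = c_coeff n i j * (-1) ^ (n + j)
          * sqrt (2 * (real n - real i) + 1) * sqrt (2 * (real n - real j) + 1) * ?F"
    unfolding S sgn c_coeff_def q4 q5 h_factor_reflected_0[OF i(1)] two h_def[symmetric]
    using i by (simp add: J_def of_nat_diff right_diff_distrib)
  finally show ?thesis .
qed

text \<open>
  For even \<open>i\<close> the function in row \<open>n - i\<close> does not change when \<open>n\<close> and \<open>i\<close> are both lowered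
  by 1. The column
  condition \<open>1 \<le> j\<close> ensures that the entry exists in the smaller matrix.
\<close>

lemma D1_even_row:
  assumes "even i" "0 < i" "1 \<le> j" "j \<le> n" "i \<le> n"
  shows "D1 n $$ (n - i, n - j) = D1 (n - 1) $$ (n - i, n - j)"
proof -
  have "n - i = n - 1 - (i - 1)" using assms by simp
  then have "h_fun (n - 1) (n - i) = h_fun (n - 1) (n - 1 - (i - 1))" by simp
  also have "\<dots> = h_fun n (n - i)"
    using assms by (subst h_fun_zero_or_odd_index) (auto simp: h_fun_even_index)
  finally show ?thesis using assms by (simp add: D1_def)
qed

lemma D1_even_row_last_column:
  assumes "even i" "0 < i" "i \<le> n"
  shows "D1 n $$ (n - i, n) = 0"
  using assms integral_legendre_eq_0[of "n - 1" n "d_coeff (n - 1) (i - 1)"]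
  by (simp add: D1_def h_fun_even_index)

theorem theorem11:
  fixes n :: nat
  shows
    "D1 n $$ (n, n) = sqrt 2
   \<and> (\<forall>i j. odd i \<and> j \<le> i \<and> i \<le> n \<longrightarrow>
        D1 n $$ (n - i, n - j) =
          c_coeff n i j * (-1) ^ (n + j)
          * sqrt (2 * (real n - real i) + 1) * sqrt (2 * (real n - real j) + 1)
          * hypergeometric_4F3
              (- (real i - real j) / 2) ((real j - real i + 1) / 2)
              (real n - (real i + real j - 1) / 2) (real n - (real i + real j) / 2 + 1)
              (real n - real i / 2 + 3/2) (- real i / 2) (real n - real i + 3/2) 1)
   \<and> (\<forall>i j. even i \<and> 0 < i \<and> 1 \<le> j \<and> j \<le> i \<and> i \<le> n \<longrightarrow>
        D1 n $$ (n - i, n - j) = D1 (n - 1) $$ (n - i, n - j))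
   \<and> (\<forall>i j. i \<le> n \<and> j \<le> n
        \<and> \<not> (i = 0 \<and> j = 0)
        \<and> \<not> (odd i \<and> j \<le> i)
        \<and> \<not> (even i \<and> 0 < i \<and> 1 \<le> j \<and> j \<le> i) \<longrightarrow>
        D1 n $$ (n - i, n - j) = 0)"
proof (intro conjI allI impI)
  show "D1 n $$ (n, n) = sqrt 2" by (rule D1_corner)
next
  fix i j assume "odd i \<and> j \<le> i \<and> i \<le> n"
  then show "D1 n $$ (n - i, n - j) =
          c_coeff n i j * (-1) ^ (n + j)
          * sqrt (2 * (real n - real i) + 1) * sqrt (2 * (real n - real j) + 1)
          * hypergeometric_4F3
              (- (real i - real j) / 2) ((real j - real i + 1) / 2)
              (real n - (real i + real j - 1) / 2) (real n - (real i + real j) / 2 + 1)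
              (real n - real i / 2 + 3/2) (- real i / 2) (real n - real i + 3/2) 1"
    by (intro D1_odd_row) auto
next
  fix i j assume "even i \<and> 0 < i \<and> 1 \<le> j \<and> j \<le> i \<and> i \<le> n"
  then show "D1 n $$ (n - i, n - j) = D1 (n - 1) $$ (n - i, n - j)"
    by (intro D1_even_row) auto
next
  fix i j
  assume *: "i \<le> n \<and> j \<le> n \<and> \<not> (i = 0 \<and> j = 0) \<and> \<not> (odd i \<and> j \<le> i)
        \<and> \<not> (even i \<and> 0 < i \<and> 1 \<le> j \<and> j \<le> i)"
  show "D1 n $$ (n - i, n - j) = 0"
  proof (cases "i = 0 \<or> odd i")
    case True
    then show ?thesis using * by (intro D1_zero_outside_band) auto
  next
    case False
    show ?thesis
    proof (cases "j = 0")
      case True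
      then show ?thesis using * False D1_even_row_last_column[of i n] by auto
    next
      case j: False
      then have "D1 (n - 1) $$ (n - 1 - (i - 1), n - 1 - (j - 1)) = 0"
        using * False by (intro D1_zero_outside_band) (auto simp: diff_le_mono)
      then show ?thesis
        using * False j D1_even_row[of i j n] by simp
    qed
  qed
qed

end
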